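(* Let $\sigma\in\mathfrak S_n$. Then $$\mathbf F_\sigma(\mathbb X)=q^{\mathrm{maj}(\sigma)}\prod_{i=1}^n\frac{1-q^{(i-1)x_i-iy_i}\,t}{1-q^i}=\prod_{i=1}^n\frac{q^{iy_i}-q^{(i-1)x_i}\,t}{1-q^i},$$ where $x_i=0$ if $\sigma_{i-1}>\sigma_i$ and $x_i=1$ otherwise, $y_i=0$ if $\sigma_i<\sigma_{i+1}$ and $y_i=1$ otherwise, with the conventions $\sigma_0=\sigma_{n+1}=+\infty$.
   Context: For $\mu\in\mathfrak S_N$ and $\epsilon\in\{\pm1\}^N$, the signed permutation $(\mu,\epsilon)$ is identified with the integer word $w=(\epsilon_1\mu_1,\dots,\epsilon_N\mu_N)$; $\mathrm{maj}(\mu,\epsilon)=\sum_{i:\,w_i>w_{i+1}}i$ (so $\mathrm{maj}(\mu)$, all signs $+1$, is the usual major index), and $m(\epsilon)$ is the number of entries $-1$ of $\epsilon$. Let $(q)_N=\prod_{i=1}^N(1-q^i)$. $\mathbf F_\mu$ denotes the basis element of the Hopf algebra $\mathbf{FQSym}$ of free quasi-symmetric functions indexed by $\mu$, and $\mathbb X=\frac{1}{1-q}\,\hat\times\,(1-t)$ is the virtual alphabet; the $(q,t)$-specialization of $\mathbf F_\mu$ at $\mathbb X$ is the rational function $$\mathbf F_\mu(\mathbb X)=\frac{1}{(q)_N}\sum_{\epsilon\in\{\pm1\}^N}(-t)^{m(\epsilon)}q^{\mathrm{maj}(\mu,\epsilon)}.$$ *)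

theory Defs
  imports
    "HOL-Computational_Algebra.Polynomial"
    "HOL-Computational_Algebra.Fraction_Field"
    "HOL-Combinatorics.Permutations"
    "HOL-Library.FuncSet"
    "HOL-Library.Extended_Nat"
begin

text \<open>
  Rational functions in the two indeterminates \<open>q\<close>, \<open>t\<close> over a field \<open>'k\<close> are the fraction
  field of \<open>'k[q][t]\<close>: the inner polynomial variable is \<open>q\<close>, the outer one is \<open>t\<close>.
\<close>

type_synonym 'k ratfun = "'k poly poly fract"

definition qvar :: "'k::field ratfun" where
  "qvar = Fract [:[:0, 1:]:] 1"

definition tvar :: "'k::field ratfun" where
  "tvar = Fract [:0, 1:] 1"

text \<open>
  Words of length \<open>N\<close> are functions on \<open>nat\<close> of which only the values at \<open>1, \<dots>, N\<close> matter.
\<close>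

definition maj_word :: "nat \<Rightarrow> (nat \<Rightarrow> int) \<Rightarrow> nat" where
  "maj_word N w = (\<Sum>i | 1 \<le> i \<and> i < N \<and> w i > w (i + 1). i)"

definition signed_word :: "(nat \<Rightarrow> nat) \<Rightarrow> (nat \<Rightarrow> int) \<Rightarrow> nat \<Rightarrow> int" where
  "signed_word \<mu> \<epsilon> i = \<epsilon> i * int (\<mu> i)"

definition maj_signed :: "nat \<Rightarrow> (nat \<Rightarrow> nat) \<Rightarrow> (nat \<Rightarrow> int) \<Rightarrow> nat" where
  "maj_signed N \<mu> \<epsilon> = maj_word N (signed_word \<mu> \<epsilon>)"

definition maj :: "nat \<Rightarrow> (nat \<Rightarrow> nat) \<Rightarrow> nat" where
  "maj N \<mu> = maj_signed N \<mu> (\<lambda>_. 1)"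

definition sign_vectors :: "nat \<Rightarrow> (nat \<Rightarrow> int) set" where
  "sign_vectors N = {1..N} \<rightarrow>\<^sub>E {1, -1}"

definition num_minus :: "nat \<Rightarrow> (nat \<Rightarrow> int) \<Rightarrow> nat" where
  "num_minus N \<epsilon> = card {i \<in> {1..N}. \<epsilon> i = -1}"

definition qfact :: "nat \<Rightarrow> 'k::field ratfun" where
  "qfact N = (\<Prod>i=1..N. 1 - qvar ^ i)"

text \<open>
  The specialization of the basis element of FQSym indexed by \<open>\<mu> \<in> S\<^sub>N\<close> at the virtual
  alphabet \<open>1/(1-q) \<times> (1-t)\<close>.
\<close>

definition F_spec :: "nat \<Rightarrow> (nat \<Rightarrow> nat) \<Rightarrow> 'k::field ratfun" where
  "F_spec N \<mu> = 1 / qfact N *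
     (\<Sum>\<epsilon>\<in>sign_vectors N. (- tvar) ^ num_minus N \<epsilon> * qvar ^ maj_signed N \<mu> \<epsilon>)"

text \<open>The one-line word of \<open>\<sigma>\<close> with the conventions \<open>\<sigma>\<^sub>0 = \<sigma>\<^sub>n\<^sub>+\<^sub>1 = \<infinity>\<close>.\<close>

definition ext_perm :: "nat \<Rightarrow> (nat \<Rightarrow> nat) \<Rightarrow> nat \<Rightarrow> enat" where
  "ext_perm n \<sigma> i = (if i \<in> {1..n} then enat (\<sigma> i) else \<infinity>)"

text \<open>Both exponents below are only used for \<open>1 \<le> i \<le> n\<close>, so \<open>i - 1\<close> does not truncate.\<close>

definition x_exp :: "nat \<Rightarrow> (nat \<Rightarrow> nat) \<Rightarrow> nat \<Rightarrow> nat" where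
  "x_exp n \<sigma> i = (if ext_perm n \<sigma> (i - 1) > ext_perm n \<sigma> i then 0 else 1)"

definition y_exp :: "nat \<Rightarrow> (nat \<Rightarrow> nat) \<Rightarrow> nat \<Rightarrow> nat" where
  "y_exp n \<sigma> i = (if ext_perm n \<sigma> i < ext_perm n \<sigma> (i + 1) then 0 else 1)"

end

theory Submission
  imports Defs
begin

text \<open>
  The word of a signed permutation descends at \<open>i\<close> iff \<open>\<sigma>\<^sub>i < \<sigma>\<^sub>i\<^sub>+\<^sub>1\<close> and \<open>\<epsilon>\<^sub>i\<^sub>+\<^sub>1 = -1\<close>, or
  \<open>\<sigma>\<^sub>i > \<sigma>\<^sub>i\<^sub>+\<^sub>1\<close> and \<open>\<epsilon>\<^sub>i = 1\<close>. So each descent is controlled by a single sign, and the major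
  index is a sum over \<open>i\<close> of terms depending on \<open>\<epsilon>\<^sub>i\<close> alone: \<open>i y\<^sub>i\<close> for a plus sign and
  \<open>(i - 1) x\<^sub>i\<close> for a minus sign. The sum over all sign vectors therefore factors.
\<close>

lemma sum_add_Suc_eq_sum_add:
  fixes a b :: "nat \<Rightarrow> 'a::comm_monoid_add"
  assumes "a n = 0" and "b 1 = 0"
  shows "(\<Sum>i=1..<n. a i + b (Suc i)) = (\<Sum>i=1..n. a i + b i)"
proof -
  have "(\<Sum>i=1..<n. a i) = (\<Sum>i=1..n. a i)"
    using assms(1) by (intro sum.mono_neutral_left) (auto simp: nat_less_le)
  moreover have "(\<Sum>i=1..<n. b (Suc i)) = (\<Sum>i=1..n. b i)"
  proof -
    have "(\<Sum>i=1..<n. b (Suc i)) = (\<Sum>i=Suc 1..<Suc n. b i)"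
      by (rule sum.shift_bounds_Suc_ivl[symmetric])
    also have "\<dots> = (\<Sum>i=1..n. b i)"
    proof (rule sum.mono_neutral_left)
      show "\<forall>i\<in>{1..n} - {Suc 1..<Suc n}. b i = 0"
        using assms(2) by (auto simp: not_less_eq_eq le_Suc_eq)
    qed auto
    finally show ?thesis .
  qed
  ultimately show ?thesis by (simp add: sum.distrib)
qed

lemma power_mult_one_minus_power_int_diff:
  fixes q t :: "'a::field"
  assumes "q \<noteq> 0"
  shows "q ^ b * (1 - q powi (int a - int b) * t) = q ^ b - q ^ a * t"
  using assms by (simp add: power_int_diff field_simps)

lemma qvar_nonzero: "(qvar :: 'k::field ratfun) \<noteq> 0"
  unfolding qvar_def by (simp add: Zero_fract_def eq_fract)

lemma maj_word_eq_sum_if: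
  "maj_word n w = (\<Sum>i=1..<n. if w (Suc i) < w i then i else 0)"
proof -
  have "{i. 1 \<le> i \<and> i < n \<and> w (i + 1) < w i} = {i \<in> {1..<n}. w (Suc i) < w i}"
    by auto
  then show ?thesis
    unfolding maj_word_def by (simp only: sum.inter_filter finite_atLeastLessThan)
qed

lemma signed_word_less_iff:
  assumes "0 < \<mu> i" "0 < \<mu> j" "\<mu> i \<noteq> \<mu> j" and "\<epsilon> i \<in> {1, -1}" "\<epsilon> j \<in> {1, -1}"
  shows "signed_word \<mu> \<epsilon> j < signed_word \<mu> \<epsilon> i \<longleftrightarrow> (if \<mu> i < \<mu> j then \<epsilon> j = -1 else \<epsilon> i = 1)"
  using assms by (auto simp: signed_word_def)

lemma y_exp_eq_of_bool: "i \<in> {1..<n} \<Longrightarrow> y_exp n \<mu> i = of_bool (\<mu> (Suc i) \<le> \<mu> i)"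
  by (auto simp: y_exp_def ext_perm_def)

lemma x_exp_Suc_eq_of_bool: "i \<in> {1..<n} \<Longrightarrow> x_exp n \<mu> (Suc i) = of_bool (\<mu> i \<le> \<mu> (Suc i))"
  by (auto simp: x_exp_def ext_perm_def)

lemma y_exp_last: "0 < n \<Longrightarrow> y_exp n \<mu> n = 0"
  by (simp add: y_exp_def ext_perm_def)

lemma signed_word_descent_eq_add:
  assumes i: "i \<in> {1..<n}"
    and inj: "inj_on \<mu> {1..n}" and pos: "0 \<notin> \<mu> ` {1..n}" and signs: "\<epsilon> \<in> {1..n} \<rightarrow> {1, -1}"
  shows "(if signed_word \<mu> \<epsilon> (Suc i) < signed_word \<mu> \<epsilon> i then i else 0) =
    (if \<epsilon> i = 1 then i * y_exp n \<mu> i else 0) +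
    (if \<epsilon> (Suc i) = -1 then i * x_exp n \<mu> (Suc i) else 0)"
proof -
  have mem: "i \<in> {1..n}" "Suc i \<in> {1..n}"
    using i by auto
  have distinct: "\<mu> i \<noteq> \<mu> (Suc i)"
    using inj_onD[OF inj _ mem] by auto
  have "0 < \<mu> i" "0 < \<mu> (Suc i)"
    using pos mem by (metis gr0I imageI)+
  moreover have "\<epsilon> i \<in> {1, -1}" "\<epsilon> (Suc i) \<in> {1, -1}"
    using signs mem by blast+
  ultimately have "signed_word \<mu> \<epsilon> (Suc i) < signed_word \<mu> \<epsilon> i \<longleftrightarrow>
      (if \<mu> i < \<mu> (Suc i) then \<epsilon> (Suc i) = -1 else \<epsilon> i = 1)"
    using distinct by (intro signed_word_less_iff)
  then show ?thesis
    using distinct by (auto simp: y_exp_eq_of_bool[OF i] x_exp_Suc_eq_of_bool[OF i])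
qed

definition sign_exponent :: "nat \<Rightarrow> (nat \<Rightarrow> nat) \<Rightarrow> nat \<Rightarrow> int \<Rightarrow> nat" where
  "sign_exponent n \<mu> i s = (if s = 1 then i * y_exp n \<mu> i else (i - 1) * x_exp n \<mu> i)"

lemma maj_signed_eq_sum_sign_exponent:
  assumes inj: "inj_on \<mu> {1..n}" and pos: "0 \<notin> \<mu> ` {1..n}" and signs: "\<epsilon> \<in> {1..n} \<rightarrow> {1, -1}"
  shows "maj_signed n \<mu> \<epsilon> = (\<Sum>i=1..n. sign_exponent n \<mu> i (\<epsilon> i))"
proof -
  define plus_part where "plus_part i = (if \<epsilon> i = 1 then i * y_exp n \<mu> i else 0)" for i
  define minus_part where "minus_part i = (if \<epsilon> i = -1 then (i - 1) * x_exp n \<mu> i else 0)" for i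
  have "(if signed_word \<mu> \<epsilon> (Suc i) < signed_word \<mu> \<epsilon> i then i else 0) =
      plus_part i + minus_part (Suc i)"
    if "i \<in> {1..<n}" for i
    unfolding plus_part_def minus_part_def diff_Suc_1
    by (rule signed_word_descent_eq_add[OF that inj pos signs])
  then have "maj_signed n \<mu> \<epsilon> = (\<Sum>i=1..<n. plus_part i + minus_part (Suc i))"
    unfolding maj_signed_def maj_word_eq_sum_if by (intro sum.cong refl)
  also have "\<dots> = (\<Sum>i=1..n. plus_part i + minus_part i)"
  proof (rule sum_add_Suc_eq_sum_add)
    show "plus_part n = 0"
      by (cases "n = 0") (simp_all add: plus_part_def y_exp_last)
    show "minus_part 1 = 0"
      by (simp add: minus_part_def)
  qed
  also have "\<dots> = (\<Sum>i=1..n. sign_exponent n \<mu> i (\<epsilon> i))"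
  proof (intro sum.cong refl)
    fix i assume "i \<in> {1..n}"
    with signs have "\<epsilon> i \<in> {1, -1}" by blast
    then show "plus_part i + minus_part i = sign_exponent n \<mu> i (\<epsilon> i)"
      by (auto simp: plus_part_def minus_part_def sign_exponent_def)
  qed
  finally show ?thesis .
qed

lemma maj_eq_sum_y_exp:
  assumes "inj_on \<mu> {1..n}" and "0 \<notin> \<mu> ` {1..n}"
  shows "maj n \<mu> = (\<Sum>i=1..n. i * y_exp n \<mu> i)"
  unfolding maj_def by (simp add: maj_signed_eq_sum_sign_exponent[OF assms] sign_exponent_def)

lemma power_num_minus:
  fixes c :: "'a::comm_monoid_mult"
  shows "c ^ num_minus n \<epsilon> = (\<Prod>i=1..n. if \<epsilon> i = -1 then c else 1)"
  unfolding num_minus_def by (subst prod.inter_filter[symmetric]) simp_all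

lemma sum_sign_vectors_prod:
  fixes f :: "nat \<Rightarrow> int \<Rightarrow> 'a::comm_semiring_1"
  shows "(\<Sum>\<epsilon>\<in>sign_vectors n. \<Prod>i=1..n. f i (\<epsilon> i)) = (\<Prod>i=1..n. f i 1 + f i (-1))"
  unfolding sign_vectors_def by (subst prod_sum_PiE[symmetric]) simp_all

lemma sum_sign_vectors_maj_signed:
  fixes q t :: "'a::comm_ring_1"
  assumes "inj_on \<mu> {1..n}" and "0 \<notin> \<mu> ` {1..n}"
  shows "(\<Sum>\<epsilon>\<in>sign_vectors n. (- t) ^ num_minus n \<epsilon> * q ^ maj_signed n \<mu> \<epsilon>) =
    (\<Prod>i=1..n. q ^ (i * y_exp n \<mu> i) - q ^ ((i - 1) * x_exp n \<mu> i) * t)"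
proof -
  define f where "f i s = (if s = -1 then - t else 1) * q ^ sign_exponent n \<mu> i s" for i s
  have "(- t) ^ num_minus n \<epsilon> * q ^ maj_signed n \<mu> \<epsilon> = (\<Prod>i=1..n. f i (\<epsilon> i))"
    if "\<epsilon> \<in> sign_vectors n" for \<epsilon>
  proof -
    have "\<epsilon> \<in> {1..n} \<rightarrow> {1, -1}"
      using that by (simp add: sign_vectors_def PiE_def)
    then show ?thesis
      by (simp add: f_def power_num_minus maj_signed_eq_sum_sign_exponent[OF assms] power_sum
          prod.distrib)
  qed
  then have "(\<Sum>\<epsilon>\<in>sign_vectors n. (- t) ^ num_minus n \<epsilon> * q ^ maj_signed n \<mu> \<epsilon>) =
      (\<Prod>i=1..n. f i 1 + f i (-1))"
    by (simp only: sum_sign_vectors_prod cong: sum.cong)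
  then show ?thesis
    by (simp add: f_def sign_exponent_def mult.commute)
qed

lemma power_maj_mult_prod:
  fixes q t :: "'a::field"
  assumes "inj_on \<mu> {1..n}" and "0 \<notin> \<mu> ` {1..n}" and q: "q \<noteq> 0"
  shows "q ^ maj n \<mu> *
      (\<Prod>i=1..n. 1 - q powi ((int i - 1) * int (x_exp n \<mu> i) - int i * int (y_exp n \<mu> i)) * t) =
    (\<Prod>i=1..n. q ^ (i * y_exp n \<mu> i) - q ^ ((i - 1) * x_exp n \<mu> i) * t)"
  unfolding maj_eq_sum_y_exp[OF assms(1,2)] power_sum prod.distrib[symmetric]
proof (intro prod.cong refl)
  fix i assume "i \<in> {1..n}"
  then have "(int i - 1) * int (x_exp n \<mu> i) - int i * int (y_exp n \<mu> i) =
      int ((i - 1) * x_exp n \<mu> i) - int (i * y_exp n \<mu> i)"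
    by (simp add: of_nat_diff)
  then show "q ^ (i * y_exp n \<mu> i) *
      (1 - q powi ((int i - 1) * int (x_exp n \<mu> i) - int i * int (y_exp n \<mu> i)) * t) =
    q ^ (i * y_exp n \<mu> i) - q ^ ((i - 1) * x_exp n \<mu> i) * t"
    by (simp only: power_mult_one_minus_power_int_diff[OF q])
qed

theorem theorem3p9:
  fixes n :: nat and \<sigma> :: "nat \<Rightarrow> nat"
  assumes "\<sigma> permutes {1..n}"
  shows "(F_spec n \<sigma> :: 'k::field ratfun) =
           qvar ^ maj n \<sigma> *
           (\<Prod>i=1..n. (1 - qvar powi ((int i - 1) * int (x_exp n \<sigma> i) - int i * int (y_exp n \<sigma> i)) * tvar)
                      / (1 - qvar ^ i)) \<and>
         qvar ^ maj n \<sigma> *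
           (\<Prod>i=1..n. (1 - qvar powi ((int i - 1) * int (x_exp n \<sigma> i) - int i * int (y_exp n \<sigma> i)) * tvar)
                      / (1 - qvar ^ i)) =
           (\<Prod>i=1..n. (qvar ^ (i * y_exp n \<sigma> i) - qvar ^ ((i - 1) * x_exp n \<sigma> i) * tvar)
                      / (1 - qvar ^ i) :: 'k ratfun)"
    (is "_ = ?M \<and> ?M = ?R")
proof
  have word: "inj_on \<sigma> {1..n}" "0 \<notin> \<sigma> ` {1..n}"
    using assms by (simp_all add: permutes_inj_on permutes_image)
  show "?M = ?R"
    unfolding prod_dividef times_divide_eq_right power_maj_mult_prod[OF word qvar_nonzero] ..
  moreover have "F_spec n \<sigma> = ?R"
    unfolding F_spec_def qfact_def sum_sign_vectors_maj_signed[OF word] prod_dividef by simp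
  ultimately show "F_spec n \<sigma> = ?M"
    by simp
qed

end
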